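(* Let $G(z)$ be a rational power series with nonnegative real coefficients that satisfies $G(0)=0$. Then the relation $$F(z)=\frac{1}{1-G(z)}$$ is supercritical.
   Context: A power series is rational if it is the power series expansion at $0$ of a quotient of two polynomials (with denominator nonzero at $0$). Supercritical: let $F$ and $G$ be two generating functions with nonnegative real coefficients that are analytic at $0$, and assume that $G(0)=0$. The relation $F(z)=\frac{1}{1-G(z)}$ is called supercritical if $G(R_G)>1$, where $R_G$ is the radius of convergence of $G$. Here $G(R_G)\in[0,\infty]$ is understood as the limit of $G(x)$ as $x\to R_G$ from the left along the real axis, and $R_G=\infty$ is allowed (for example when $G$ is a polynomial).
   Formalization: The power series G is assumed to be nonzero; for G = 0 the claim is false, since then R_G is infinite and G(R_G) = 0, which is not greater than 1. *)

theory Defs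
  imports "HOL-Analysis.FPS_Convergence"
begin

definition rational_fps :: "real fps \<Rightarrow> bool" where
  "rational_fps G \<longleftrightarrow>
     (\<exists>P Q :: real poly. poly Q 0 \<noteq> 0 \<and> (\<lambda>z. poly P z / poly Q z) has_fps_expansion G)"

definition nonneg_fps :: "real fps \<Rightarrow> bool" where
  "nonneg_fps G \<longleftrightarrow> (\<forall>n. fps_nth G n \<ge> 0)"

(* The value of G at its radius of convergence R, as a left limit in the extended reals.
   The filter at_left R is taken on ereal: for R = \<infinity> it is x tending to \<infinity> along the reals,
   and for finite R it is the usual one-sided limit. *)
definition has_value_at_conv_radius :: "real fps \<Rightarrow> ereal \<Rightarrow> bool" where
  "has_value_at_conv_radius G L \<longleftrightarrow>
     ((\<lambda>x. ereal (eval_fps G (real_of_ereal x))) \<longlongrightarrow> L) (at_left (fps_conv_radius G))"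

(* The standing assumptions on F and G are part of the notion. In F = 1 / (1 - G) the
   division is that of formal power series; 1 - G is a unit because G(0) = 0. *)
definition supercritical :: "real fps \<Rightarrow> real fps \<Rightarrow> bool" where
  "supercritical F G \<longleftrightarrow>
     nonneg_fps F \<and> nonneg_fps G \<and>
     fps_conv_radius F > 0 \<and> fps_conv_radius G > 0 \<and>
     fps_nth G 0 = 0 \<and>
     F = 1 / (1 - G) \<and>
     (\<exists>L. has_value_at_conv_radius G L \<and> L > 1)"

end

theory Submission
  imports Defs "HOL-Computational_Algebra.Fundamental_Theorem_Algebra"
begin

unbundle no vec_syntax
unbundle fps_syntax

text \<open>If \<open>G\<close> is bounded on \<open>[0, R)\<close> with \<open>R\<close> its finite radius of convergence, then, having nonnegative
  coefficients, its series converges absolutely on the closed complex disc of radius \<open>R\<close>. After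
  cancelling common factors in \<open>G = P / Q\<close>, the denominator has no root in that disc, so the radius
  of convergence exceeds \<open>R\<close>, a contradiction. Hence \<open>G(x)\<close> tends to infinity at \<open>R\<close>; for \<open>R = \<infinity>\<close>
  a single nonzero coefficient of positive index suffices.\<close>

section \<open>Linear factors and absolute summability with weight \<open>R\<close>\<close>

text \<open>The series is the geometric expansion of \<open>1 / (z - a)\<close> at 0; it later
  serves to divide by a factor whose root lies outside the disc.\<close>

lemma geometric_fps_linear_factor:
  fixes a :: "'a :: field"
  assumes "a \<noteq> 0"
  shows "fps_of_poly [:-a, 1:] * Abs_fps (\<lambda>n. - ((1 / a) ^ Suc n)) = 1"
proof (rule fps_ext)
  fix n
  have "fps_of_poly [:-a, 1:] = fps_X - fps_const a"
    by (simp add: fps_of_poly_linear)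
  then show "(fps_of_poly [:-a, 1:] * Abs_fps (\<lambda>n. - ((1 / a) ^ Suc n))) $ n = (1 :: 'a fps) $ n"
    using assms by (cases n) (simp_all only:, simp_all add: left_diff_distrib)
qed

lemma conv_radius_geometric_fps:
  fixes a :: complex
  assumes "a \<noteq> 0"
  shows "fps_conv_radius (Abs_fps (\<lambda>n. - ((1 / a) ^ Suc n))) \<ge> norm a"
  unfolding fps_conv_radius_def
proof (rule conv_radius_geI_ex')
  fix r :: real
  assume r: "0 < r" "ereal r < ereal (norm a)"
  have "norm (of_real r / a) < 1"
    using r assms by (simp add: norm_divide)
  then have "summable (\<lambda>n. (- 1 / a) * (of_real r / a) ^ n)"
    by (intro summable_mult summable_geometric)
  then show "summable (\<lambda>n. (Abs_fps (\<lambda>n. - ((1 / a) ^ Suc n))) $ n * of_real r ^ n)"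
    by (simp add: power_divide field_simps)
qed

text \<open>Multiplying by \<open>z - a\<close> only combines neighbouring coefficients, so two
  scaled copies of the given series dominate. This lets the induction on the denominator continue
  after a factor has been moved into \<open>G\<close>.\<close>

lemma summable_norm_mult_linear:
  fixes G :: "complex fps"
  assumes "summable (\<lambda>n. norm (G $ n) * R ^ n)" and "R \<ge> 0"
  shows "summable (\<lambda>n. norm ((fps_of_poly [:-a, 1:] * G) $ n) * R ^ n)"
proof -
  have "fps_of_poly [:-a, 1:] = fps_X - fps_const a"
    by (simp add: fps_of_poly_linear)
  then have nth: "(fps_of_poly [:-a, 1:] * G) $ Suc n = G $ n - a * G $ Suc n" for n
    by (simp only:) (simp add: left_diff_distrib)
  have "summable (\<lambda>n. R * (norm (G $ n) * R ^ n) + norm a * (norm (G $ Suc n) * R ^ Suc n))"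
    using assms(1) summable_Suc_iff[of "\<lambda>n. norm (G $ n) * R ^ n"]
    by (intro summable_add summable_mult) auto
  then have "summable (\<lambda>n. norm ((fps_of_poly [:-a, 1:] * G) $ Suc n) * R ^ Suc n)"
  proof (rule summable_comparison_test')
    fix n
    have "norm (G $ n - a * G $ Suc n) * R ^ Suc n
        \<le> (norm (G $ n) + norm a * norm (G $ Suc n)) * R ^ Suc n"
      using norm_triangle_ineq4[of "G $ n" "a * G $ Suc n"] assms(2)
      by (intro mult_right_mono) (auto simp: norm_mult)
    then show "norm (norm ((fps_of_poly [:-a, 1:] * G) $ Suc n) * R ^ Suc n)
        \<le> R * (norm (G $ n) * R ^ n) + norm a * (norm (G $ Suc n) * R ^ Suc n)"
      using assms(2) unfolding nth by (simp add: algebra_simps abs_mult)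
  qed
  then show ?thesis
    by (subst (asm) summable_Suc_iff)
qed

section \<open>Rational complex series that converge absolutely on a closed disc\<close>

text \<open>Absolute convergence makes the Cauchy product valid at \<open>z\<close>, even on the
  boundary circle, so the formal identity evaluates to \<open>Q(z) G(z) = P(z)\<close> with a finite
  value \<open>G(z)\<close>.\<close>

lemma poly_root_numerator:
  fixes G :: "complex fps"
  assumes "summable (\<lambda>n. norm (G $ n) * R ^ n)" and "norm z \<le> R"
    and "fps_of_poly Q * G = fps_of_poly P" and "poly Q z = 0"
  shows "poly P z = 0"
proof -
  have Q: "summable (\<lambda>k. norm (fps_of_poly Q $ k * z ^ k))"
    by (rule norm_summable_fps) simp
  have G: "summable (\<lambda>k. norm (G $ k * z ^ k))"
  proof (rule summable_comparison_test'[OF assms(1)])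
    fix n
    have "norm z ^ n \<le> R ^ n"
      using assms(2) by (intro power_mono) auto
    then show "norm (norm (G $ n * z ^ n)) \<le> norm (G $ n) * R ^ n"
      by (simp add: norm_mult norm_power mult_left_mono)
  qed
  have "(\<lambda>k. \<Sum>i\<le>k. (fps_of_poly Q $ i * z ^ i) * (G $ (k - i) * z ^ (k - i)))
      sums ((\<Sum>k. fps_of_poly Q $ k * z ^ k) * (\<Sum>k. G $ k * z ^ k))"
    by (rule Cauchy_product_sums[OF Q G])
  also have "(\<lambda>k. \<Sum>i\<le>k. (fps_of_poly Q $ i * z ^ i) * (G $ (k - i) * z ^ (k - i)))
      = (\<lambda>k. (fps_of_poly Q * G) $ k * z ^ k)"
  proof (rule ext)
    fix k
    have *: "z ^ i * z ^ (k - i) = z ^ k" if "i \<le> k" for i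
      using that by (simp flip: power_add)
    have "(\<Sum>i\<le>k. (fps_of_poly Q $ i * z ^ i) * (G $ (k - i) * z ^ (k - i)))
        = (\<Sum>i\<le>k. fps_of_poly Q $ i * G $ (k - i) * (z ^ i * z ^ (k - i)))"
      by (simp add: mult_ac)
    also have "\<dots> = (\<Sum>i\<le>k. fps_of_poly Q $ i * G $ (k - i) * z ^ k)"
      by (intro sum.cong) (auto simp: *)
    finally show "(\<Sum>i\<le>k. (fps_of_poly Q $ i * z ^ i) * (G $ (k - i) * z ^ (k - i)))
        = (fps_of_poly Q * G) $ k * z ^ k"
      by (simp add: fps_mult_nth sum_distrib_right atLeast0AtMost)
  qed
  finally have "(\<lambda>k. fps_of_poly P $ k * z ^ k) sums (poly Q z * (\<Sum>k. G $ k * z ^ k))"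
    unfolding assms(3) by (simp only: eval_fps_def flip: eval_fps_of_poly)
  then have "eval_fps (fps_of_poly P) z = 0"
    using assms(4) by (auto simp: eval_fps_def sums_iff)
  then show ?thesis
    by simp
qed

text \<open>Induction on the degree of \<open>Q\<close>: a linear factor of \<open>Q\<close> with root \<open>a\<close> is cancelled if
  \<open>norm a \<le> R\<close>, since then \<open>a\<close> is a root of \<open>P\<close> as well, and is moved into \<open>G\<close> otherwise.\<close>

lemma rational_conv_radius_gt:
  fixes G :: "complex fps"
  assumes "R \<ge> 0" and "summable (\<lambda>n. norm (G $ n) * R ^ n)"
    and "poly Q 0 \<noteq> 0" and "fps_of_poly Q * G = fps_of_poly P"
  shows "fps_conv_radius G > R"
  using assms(2-)
proof (induction "degree Q" arbitrary: Q P G)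
  case 0
  then obtain c where c: "Q = [:c:]" "c \<noteq> 0"
    by (metis degree_eq_zeroE pCons_0_0 poly_0)
  \<comment> \<open>This product is the polynomial \<open>P\<close>.\<close>
  have "fps_conv_radius (fps_const c * G) = \<infinity>"
    using 0 c by (simp add: fps_of_poly_const)
  then show ?case
    using c by (simp add: fps_conv_radius_cmult_left)
next
  case (Suc d)
  obtain a where a: "poly Q a = 0"
    using Suc.hyps(2) fundamental_theorem_of_algebra[of Q] constant_degree[of Q] by auto
  with Suc.prems have "a \<noteq> 0"
    by auto
  from a obtain Q' where Q': "Q = [:-a, 1:] * Q'"
    by (auto simp: poly_eq_0_iff_dvd)
  have "Q' \<noteq> 0"
    using Suc.prems Q' by auto
  then have deg: "degree Q' = d"
    using Suc.hyps(2) unfolding Q' by (subst (asm) degree_mult_eq) auto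
  have Q'0: "poly Q' 0 \<noteq> 0"
    using Suc.prems Q' by auto
  show ?case
  proof (cases "norm a \<le> R")
    case True
    then have "poly P a = 0"
      using Suc.prems a poly_root_numerator by blast
    then obtain P' where P': "P = [:-a, 1:] * P'"
      by (auto simp: poly_eq_0_iff_dvd)
    have "fps_of_poly [:-a, 1:] \<noteq> 0"
      using fps_of_poly_eq_iff[of "[:-a, 1:]" 0] by simp
    moreover have "fps_of_poly [:-a, 1:] * (fps_of_poly Q' * G) = fps_of_poly [:-a, 1:] * fps_of_poly P'"
      using Suc.prems(3) unfolding Q' P' fps_of_poly_mult by (simp only: mult.assoc)
    ultimately have "fps_of_poly Q' * G = fps_of_poly P'"
      by (simp only: mult_cancel_left) simp
    then show ?thesis
      using Suc.hyps(1) deg Suc.prems(1) Q'0 by blast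
  next
    case False
    define G' where "G' = fps_of_poly [:-a, 1:] * G"
    \<comment> \<open>\<open>H\<close> is the inverse of \<open>z - a\<close>. Its radius is at
      least \<open>norm a\<close>, which exceeds \<open>R\<close> here, so multiplying back by
      \<open>H\<close> keeps the radius above \<open>R\<close>.\<close>
    define H where "H = Abs_fps (\<lambda>n. - ((1 / a) ^ Suc n))"
    have "fps_of_poly Q' * G' = fps_of_poly P"
      using Suc.prems(3) unfolding Q' G'_def fps_of_poly_mult by (simp only: mult_ac)
    then have "fps_conv_radius G' > R"
      using Suc.hyps(1) deg Q'0 summable_norm_mult_linear[OF Suc.prems(1) assms(1)]
      unfolding G'_def by blast
    moreover have "fps_conv_radius H > R"
      using False conv_radius_geometric_fps[OF \<open>a \<noteq> 0\<close>] unfolding H_def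
      by (metis less_ereal.simps(1) linorder_not_le order_less_le_trans)
    moreover have "G = H * G'"
      using geometric_fps_linear_factor[OF \<open>a \<noteq> 0\<close>] unfolding G'_def H_def
      by (metis mult.assoc mult.commute mult.right_neutral)
    ultimately show ?thesis
      using fps_conv_radius_mult[of H G'] by (metis min_less_iff_conj order_less_le_trans)
  qed
qed

section \<open>From functions to formal series, and from real to complex coefficients\<close>

text \<open>A nonzero difference is a power of \<open>z\<close> times a series with nonzero constant
  term, hence has no zero in a small punctured neighbourhood of 0.\<close>

lemma fps_eq_of_eventually_eval_eq:
  fixes f g :: "'a :: {banach, real_normed_field} fps"
  assumes "fps_conv_radius f > 0" and "fps_conv_radius g > 0"
    and "eventually (\<lambda>z. eval_fps f z = eval_fps g z) (nhds 0)"
  shows "f = g"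
proof (rule ccontr)
  assume "f \<noteq> g"
  define h where "h = f - g"
  define k where "k = fps_shift (subdegree h) h"
  have rad: "fps_conv_radius h > 0"
    using fps_conv_radius_diff[of f g] assms(1,2) unfolding h_def
    by (metis min_less_iff_conj order_less_le_trans)
  have h: "h = k * fps_X ^ subdegree h"
    unfolding k_def by (rule subdegree_decompose)
  have "k $ 0 \<noteq> 0"
    using \<open>f \<noteq> g\<close> by (simp add: k_def flip: right_minus_eq[of f g] h_def)
  have radk: "fps_conv_radius k > 0"
    using rad by (simp add: k_def)
  have "eval_fps k \<midarrow>0\<rightarrow> k $ 0"
    using continuous_eval_fps[of 0 k UNIV] radk
    by (simp add: continuous_within eval_fps_at_0 zero_ereal_def)
  then have nz: "eventually (\<lambda>z. eval_fps k z \<noteq> 0) (at 0)"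
    using \<open>k $ 0 \<noteq> 0\<close> by (rule tendsto_imp_eventually_ne)
  \<comment> \<open>\<open>eval_fps\<close> respects differences and products inside the discs of
    convergence, so \<open>z\<close> is confined to them.\<close>
  have ball: "eventually (\<lambda>z. z \<in> eball 0 r) (at 0)" if "r > 0" for r :: ereal
    using that by (intro eventually_at_in_open') (auto simp: zero_ereal_def)
  have eq: "eventually (\<lambda>z. eval_fps f z = eval_fps g z) (at 0)"
    using assms(3) by (simp add: eventually_nhds_conv_at)
  have "eventually (\<lambda>z::'a. False) (at 0)"
    using nz eq eventually_neq_at_within[of "0 :: 'a"] ball[OF assms(1)] ball[OF assms(2)] ball[OF radk]
  proof eventually_elim
    case (elim z)
    then have "eval_fps h z = 0"
      by (simp add: h_def eval_fps_diff)
    moreover have "eval_fps h z = eval_fps k z * z ^ subdegree h"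
      using elim by (subst h) (simp add: eval_fps_mult)
    ultimately show False
      using elim by simp
  qed
  then show False
    by simp
qed

text \<open>Summability at \<open>R\<close> would push the radius beyond \<open>R\<close> by
  \<open>rational_conv_radius_gt\<close>. That lemma splits off complex roots, so the identity
  \<open>Q G = P\<close> is first made formal and then carried over to complex coefficients.\<close>

lemma rational_fps_not_summable_at_conv_radius:
  assumes "rational_fps G" and "fps_conv_radius G = ereal R"
  shows "\<not> summable (\<lambda>n. norm (G $ n) * R ^ n)"
proof
  assume sm: "summable (\<lambda>n. norm (G $ n) * R ^ n)"
  from assms(1) obtain P Q :: "real poly" where Q0: "poly Q 0 \<noteq> 0"
    and exp: "(\<lambda>z. poly P z / poly Q z) has_fps_expansion G"
    unfolding rational_fps_def by blast
  have expQ: "poly Q has_fps_expansion fps_of_poly Q"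
    by (simp add: has_fps_expansion_def)
  \<comment> \<open>Division by zero yields 0, so \<open>Q * (P / Q) = P\<close> holds only away
    from the roots of \<open>Q\<close>; near 0 there are none.\<close>
  have ev: "eventually (\<lambda>z. poly Q z \<noteq> 0) (nhds 0)"
  proof -
    have "((poly Q) \<longlongrightarrow> poly Q 0) (nhds 0)"
      by (simp add: tendsto_at_iff_tendsto_nhds[symmetric] isContD)
    then show ?thesis
      using Q0 by (rule tendsto_imp_eventually_ne)
  qed
  have "eventually (\<lambda>z. eval_fps (fps_of_poly Q * G) z = eval_fps (fps_of_poly P) z) (nhds 0)"
    using has_fps_expansion_mult[OF expQ exp] ev
    unfolding has_fps_expansion_def by (auto elim: eventually_elim2)
  moreover have "fps_conv_radius (fps_of_poly Q * G) > 0"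
    using has_fps_expansion_mult[OF expQ exp] by (simp add: has_fps_expansion_def)
  ultimately have eq: "fps_of_poly Q * G = fps_of_poly P"
    by (intro fps_eq_of_eventually_eval_eq) auto
  \<comment> \<open>The same coefficients read as complex numbers: norms, and with them summability
    and radius, are unchanged.\<close>
  define G' :: "complex fps" where "G' = Abs_fps (\<lambda>n. of_real (G $ n))"
  have "fps_of_poly (map_poly of_real Q) * G' = fps_of_poly (map_poly of_real P :: complex poly)"
  proof (rule fps_ext)
    fix n
    have "of_real ((fps_of_poly Q * G) $ n) = (of_real (fps_of_poly P $ n) :: complex)"
      by (simp add: eq)
    then show "(fps_of_poly (map_poly of_real Q) * G') $ n
        = fps_of_poly (map_poly of_real P :: complex poly) $ n"
      by (simp add: fps_mult_nth G'_def coeff_map_poly)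
  qed
  moreover have "poly (map_poly of_real Q) (0 :: complex) \<noteq> 0"
    using Q0 by (simp add: poly_0_coeff_0 coeff_map_poly)
  moreover have "R \<ge> 0"
    using conv_radius_nonneg[of "fps_nth G"] assms(2) by (simp add: fps_conv_radius_def)
  moreover have "summable (\<lambda>n. norm (G' $ n) * R ^ n)"
    using sm by (simp add: G'_def)
  ultimately have "fps_conv_radius G' > R"
    by (intro rational_conv_radius_gt)
  moreover have "fps_conv_radius G' = fps_conv_radius G"
    by (simp add: fps_conv_radius_def conv_radius_def G'_def)
  ultimately show False
    using assms(2) by simp
qed

section \<open>Growth of \<open>G\<close> towards its radius of convergence\<close>

lemma sum_le_eval_fps:
  assumes "nonneg_fps G" and "0 \<le> x" and "ereal x < fps_conv_radius G"
  shows "(\<Sum>n<N. G $ n * x ^ n) \<le> eval_fps G x"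
  unfolding eval_fps_def
  using assms by (intro sum_le_suminf summable_fps) (auto simp: nonneg_fps_def)

lemma eval_fps_mono:
  assumes "nonneg_fps G" and "0 \<le> x" and "x \<le> y" and "ereal y < fps_conv_radius G"
  shows "eval_fps G x \<le> eval_fps G y"
proof -
  have "ereal x < fps_conv_radius G"
    using assms(3,4) by (metis ereal_less_eq(3) order_le_less_trans)
  then show ?thesis
    unfolding eval_fps_def
    using assms by (intro suminf_le summable_fps mult_left_mono power_mono) (auto simp: nonneg_fps_def)
qed

lemma rational_fps_unbounded:
  assumes "rational_fps G" and "nonneg_fps G" and "G $ 0 = 0" and "G \<noteq> 0"
  shows "\<exists>x \<ge> 0. ereal x < fps_conv_radius G \<and> eval_fps G x > M"
proof (rule ccontr)
  assume "\<not> ?thesis"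
  then have bd: "eval_fps G x \<le> M" if "0 \<le> x" "ereal x < fps_conv_radius G" for x
    using that by force
  have pos: "fps_conv_radius G > 0"
    using assms(1) by (auto simp: rational_fps_def has_fps_expansion_def)
  then consider R where "fps_conv_radius G = ereal R" "R > 0" | "fps_conv_radius G = \<infinity>"
    by (cases "fps_conv_radius G") auto
  then show False
  proof cases
    case 1
    \<comment> \<open>Each partial sum is a polynomial in \<open>x\<close>, so its bound on
      \<open>(0, R)\<close> passes to \<open>R\<close> by continuity; the bound is uniform in
      \<open>N\<close>.\<close>
    have "(\<Sum>n<N. G $ n * R ^ n) \<le> M" for N
    proof (rule tendsto_upperbound)
      show "((\<lambda>x. \<Sum>n<N. G $ n * x ^ n) \<longlongrightarrow> (\<Sum>n<N. G $ n * R ^ n)) (at_left R)"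
        by (intro tendsto_intros)
      show "\<forall>\<^sub>F x in at_left R. (\<Sum>n<N. G $ n * x ^ n) \<le> M"
        unfolding eventually_at_left[OF \<open>R > 0\<close>]
      proof (intro exI[of _ 0] conjI \<open>R > 0\<close> allI impI)
        fix x assume "0 < x" "x < R"
        then show "(\<Sum>n<N. G $ n * x ^ n) \<le> M"
          using sum_le_eval_fps[OF assms(2), of x N] bd[of x] 1 by simp
      qed
    qed simp
    then have "summable (\<lambda>n. norm (G $ n) * R ^ n)"
      using assms(2) 1 by (intro summableI_nonneg_bounded[of _ M]) (auto simp: nonneg_fps_def)
    then show False
      using rational_fps_not_summable_at_conv_radius[OF assms(1)] 1 by blast
  next
    case 2
    obtain n where n: "G $ n \<noteq> 0"
      using assms(4) by (auto simp: fps_eq_iff)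
    with assms(2,3) have n': "G $ n > 0" "n \<ge> 1"
      by (auto simp: nonneg_fps_def less_le intro: Suc_leI gr0I)
    \<comment> \<open>Chosen so that \<open>G $ n * x\<close> exceeds \<open>M\<close>; since also
      \<open>x \<ge> 1\<close> and \<open>n \<ge> 1\<close>, replacing \<open>x\<close> by
      \<open>x ^ n\<close> only increases the term.\<close>
    define x where "x = \<bar>M\<bar> / G $ n + 1"
    have "x \<ge> 1"
      using n' by (simp add: x_def)
    have "G $ n * x = \<bar>M\<bar> + G $ n"
      using n' by (simp add: x_def field_simps)
    with n' have "M < G $ n * x"
      by linarith
    also have "\<dots> \<le> G $ n * x ^ n"
      using n' \<open>x \<ge> 1\<close> by (intro mult_left_mono self_le_power) auto
    also have "\<dots> \<le> (\<Sum>k<Suc n. G $ k * x ^ k)"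
      using assms(2) \<open>x \<ge> 1\<close> by (intro member_le_sum) (auto simp: nonneg_fps_def)
    also have "\<dots> \<le> M"
      using sum_le_eval_fps[OF assms(2), of x "Suc n"] bd[of x] 2 \<open>x \<ge> 1\<close> by simp
    finally show False
      by simp
  qed
qed

text \<open>By monotonicity, one point where \<open>G\<close> exceeds \<open>M\<close> forces all
  later values above \<open>M\<close>, so unboundedness becomes a limit, for finite and infinite
  radius alike.\<close>

lemma rational_fps_value_at_conv_radius:
  assumes "rational_fps G" and "nonneg_fps G" and "G $ 0 = 0" and "G \<noteq> 0"
  shows "has_value_at_conv_radius G \<infinity>"
  unfolding has_value_at_conv_radius_def tendsto_PInfty
proof
  fix M :: real
  obtain x where x: "x \<ge> 0" "ereal x < fps_conv_radius G" "eval_fps G x > M"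
    using rational_fps_unbounded[OF assms] by blast
  have "M < eval_fps G (real_of_ereal y)" if y: "ereal x < y" "y < fps_conv_radius G" for y
  proof -
    \<comment> \<open>The strict bounds make \<open>y\<close> finite, so
      \<open>real_of_ereal y\<close> is not the default 0 taken at infinity.\<close>
    obtain r where "y = ereal r"
      using y by (cases y) auto
    then show ?thesis
      using y x eval_fps_mono[OF assms(2), of x r] by simp
  qed
  then show "\<forall>\<^sub>F y in at_left (fps_conv_radius G). ereal M < ereal (eval_fps G (real_of_ereal y))"
    unfolding eventually_at_left[OF x(2)] using x(2) by auto
qed

section \<open>The series \<open>1 / (1 - G)\<close> and the conclusion\<close>

text \<open>The equation \<open>F = 1 + G * F\<close> expresses each coefficient of \<open>F\<close>
  through earlier ones with nonnegative weights.\<close>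

lemma nonneg_fps_quasi_inverse:
  assumes "nonneg_fps G" and "G $ 0 = 0"
  shows "nonneg_fps (1 / (1 - G))"
proof -
  define F where "F = 1 / (1 - G)"
  have "F * (1 - G) = 1"
    using assms(2) unfolding F_def by (simp add: fps_divide_unit inverse_mult_eq_1)
  then have F: "F = 1 + G * F"
    by (simp add: algebra_simps)
  have "F $ n \<ge> 0" for n
  proof (induction n rule: less_induct)
    case (less n)
    \<comment> \<open>The term \<open>i = 0\<close> would involve \<open>F $ n\<close> itself, but
      it vanishes because \<open>G $ 0 = 0\<close>.\<close>
    have "G $ i * F $ (n - i) \<ge> 0" if "i \<le> n" for i
      using that assms less by (cases "i = 0") (auto simp: nonneg_fps_def)
    then have "(G * F) $ n \<ge> 0"
      unfolding fps_mult_nth by (intro sum_nonneg) auto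
    moreover have "F $ n = (1 :: real fps) $ n + (G * F) $ n"
      by (subst F) simp
    ultimately show ?case
      by simp
  qed
  then show ?thesis
    by (simp add: nonneg_fps_def F_def)
qed

text \<open>The series \<open>G = 0\<close> must be excluded: its value at the radius of convergence
  is 0, so the relation is then not supercritical.\<close>

theorem theorem6p3:
  fixes F G :: "real fps"
  assumes "rational_fps G"
    and "nonneg_fps G"
    and "fps_nth G 0 = 0"
    and "G \<noteq> 0"
    and "F = 1 / (1 - G)"
  shows "supercritical F G"
proof -
  have pos: "fps_conv_radius G > 0"
    using assms(1) by (auto simp: rational_fps_def has_fps_expansion_def)
  then have "fps_conv_radius (1 - G) > 0"
    using fps_conv_radius_diff[of 1 G] by (simp add: min_def)
  \<comment> \<open>The constant term of \<open>1 - G\<close> is 1, so its inverse is again analytic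
    at 0.\<close>
  then have "fps_conv_radius F > 0"
    using assms(3,5) by (simp add: fps_divide_unit fps_conv_radius_inverse_pos)
  moreover have "nonneg_fps F"
    using nonneg_fps_quasi_inverse assms by blast
  moreover have "has_value_at_conv_radius G \<infinity>"
    using rational_fps_value_at_conv_radius assms by blast
  ultimately show ?thesis
    unfolding supercritical_def using assms pos by (auto intro!: exI[of _ "\<infinity> :: ereal"])
qed

end
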